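(* Let $r\ge 2$ be an integer and let $H$ be an $r$-uniform hypergraph that is not $r$-partite. Then for every integer $k\ge 1$, \[ R_\ell(H,k)\ \ge\ c_r\cdot (1-\pi(H))^{-k/(r-1)},\qquad\text{where } c_r=\big((r-2)!/e\big)^{1/(r-1)}. \]
   Context: An $r$-graph is an $r$-uniform hypergraph. $K_n^{(r)}$ is the complete $r$-graph on $n$ vertices. For a list assignment $L:E(K_n^{(r)})\to\binom{\mathbb N}{k}$ (each edge receives a set of $k$ colors), an $L$-coloring is an edge-coloring in which each edge $e$ receives a color from $L(e)$. The $k$-color list Ramsey number $R_\ell(H,k)$ is the smallest $n$ such that there exists $L:E(K_n^{(r)})\to\binom{\mathbb N}{k}$ for which every $L$-coloring of $K_n^{(r)}$ contains a monochromatic copy of $H$. An $r$-graph is $r$-partite if its vertex set can be partitioned into $r$ parts such that every edge has exactly one vertex in each part. The Turán density is $\pi(H)=\lim_{n\to\infty}\mathrm{ex}(n,H)\binom{n}{r}^{-1}$, where $\mathrm{ex}(n,H)$ is the maximum number of edges in an $H$-free $r$-graph on $n$ vertices. *)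

theory Defs
  imports Complex_Main "HOL-Library.FuncSet" "HOL-Library.Disjoint_Sets" "HOL-Library.Ramsey"
begin

text \<open>
  An \<open>r\<close>-graph is given by its finite vertex set \<open>V\<close> and its edge set \<open>E\<close>.  The complete
  \<open>r\<close>-graph on \<open>n\<close> vertices has vertex set \<open>{..<n}\<close> and edge set \<open>nsets {..<n} r\<close>.
\<close>

definition uniform_hypergraph :: "nat \<Rightarrow> 'a set \<Rightarrow> 'a set set \<Rightarrow> bool" where
  "uniform_hypergraph r V E \<longleftrightarrow> finite V \<and> E \<subseteq> nsets V r"

text \<open>Parts are allowed to be empty, so an edgeless \<open>r\<close>-graph is \<open>r\<close>-partite.\<close>

definition r_partite :: "nat \<Rightarrow> 'a set \<Rightarrow> 'a set set \<Rightarrow> bool" where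
  "r_partite r V E \<longleftrightarrow>
     (\<exists>P :: nat \<Rightarrow> 'a set. disjoint_family_on P {..<r} \<and> (\<Union>i<r. P i) = V \<and>
        (\<forall>e\<in>E. \<forall>i<r. card (e \<inter> P i) = 1))"

text \<open>Copies are not necessarily induced.\<close>

definition contains_copy :: "'a set \<Rightarrow> 'a set set \<Rightarrow> 'b set \<Rightarrow> 'b set set \<Rightarrow> bool" where
  "contains_copy V E W F \<longleftrightarrow> (\<exists>f. inj_on f V \<and> f ` V \<subseteq> W \<and> (\<forall>e\<in>E. f ` e \<in> F))"

text \<open>
  For \<open>E = {}\<close> and \<open>card V \<le> n\<close> there is no \<open>H\<close>-free graph on \<open>n\<close> vertices, and \<open>ex_number\<close>
  is unspecified; if \<open>E \<noteq> {}\<close> and \<open>r > 0\<close>, the maximum is over a nonempty finite set.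
\<close>

definition ex_number :: "nat \<Rightarrow> 'a set \<Rightarrow> 'a set set \<Rightarrow> nat \<Rightarrow> nat" where
  "ex_number r V E n =
     Max {card F | F. F \<subseteq> nsets {..<n} r \<and> \<not> contains_copy V E {..<n} F}"

definition turan_density :: "nat \<Rightarrow> 'a set \<Rightarrow> 'a set set \<Rightarrow> real" where
  "turan_density r V E = lim (\<lambda>n. real (ex_number r V E n) / real (n choose r))"

definition list_coloring :: "nat \<Rightarrow> nat \<Rightarrow> (nat set \<Rightarrow> nat set) \<Rightarrow> (nat set \<Rightarrow> nat) \<Rightarrow> bool" where
  "list_coloring r n L c \<longleftrightarrow> (\<forall>e \<in> nsets {..<n} r. c e \<in> L e)"

definition monochromatic_copy ::
  "nat \<Rightarrow> 'a set \<Rightarrow> 'a set set \<Rightarrow> nat \<Rightarrow> (nat set \<Rightarrow> nat) \<Rightarrow> bool" where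
  "monochromatic_copy r V E n c \<longleftrightarrow>
     (\<exists>i. contains_copy V E {..<n} {e \<in> nsets {..<n} r. c e = i})"

definition list_ramsey_number :: "nat \<Rightarrow> 'a set \<Rightarrow> 'a set set \<Rightarrow> nat \<Rightarrow> nat" where
  "list_ramsey_number r V E k =
     (LEAST n. \<exists>L \<in> nsets {..<n} r \<rightarrow> nsets (UNIV :: nat set) k.
        \<forall>c. list_coloring r n L c \<longrightarrow> monochromatic_copy r V E n c)"

end

theory Submission
  imports Defs
begin

text \<open>
  Fix a list assignment \<open>L\<close> on \<open>n\<close> vertices and an \<open>H\<close>-free graph \<open>F\<close> on \<open>N\<close> vertices, \<open>N\<close> much
  larger than \<open>n\<close>, in which every vertex has relative degree nearly \<open>\<pi>(H)\<close>.  Choose for every colour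
  \<open>i\<close> an independent random injection \<open>\<phi>\<^sub>i\<close> from the \<open>n\<close> vertices into those of \<open>F\<close>; if every edge \<open>e\<close>
  has a colour \<open>i \<in> L e\<close> with \<open>\<phi>\<^sub>i(e) \<in> F\<close>, these colours give an \<open>L\<close>-colouring without a
  monochromatic \<open>H\<close>.

  Let \<open>v\<close> be a vertex of \<open>e\<close>.  By the degree condition, the probability that \<open>e\<close> is bad is at most
  about \<open>(1 - \<pi>(H))\<^sup>k\<close> even after conditioning on all values of the injections outside \<open>e - {v}\<close>.
  Hence in the lopsided local lemma only the edges meeting \<open>e - {v}\<close> count as neighbours of \<open>e\<close>;
  there are at most \<open>(r-1) \<cdot> C(n-1, r-1) \<le> n\<^sup>r\<^sup>-\<^sup>1/(r-2)!\<close> of them, \<open>e\<close> included.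
  Probabilities appear below as ratios of cardinalities.
\<close>

subsection \<open>The lopsided local lemma\<close>

text \<open>This is \<open>(1 + 1/d) ^ d\<close> \<le> e after taking reciprocals; the constant e of
  the local lemma comes from here.\<close>

lemma one_minus_inverse_power_ge_exp:
  fixes d :: nat
  assumes "d \<ge> 1"
  shows "(1 - 1 / (real d + 1)) ^ d \<ge> 1 / exp 1"
proof -
  have "(1 + 1 / real d) ^ d \<le> exp (1 / real d) ^ d"
    using exp_ge_add_one_self[of "1 / real d"] by (intro power_mono) auto
  also have "\<dots> = exp 1"
    using assms by (simp flip: exp_of_nat_mult)
  finally have *: "(1 + 1 / real d) ^ d \<le> exp 1" .
  have "1 - 1 / (real d + 1) = 1 / (1 + 1 / real d)"
    using assms by (simp add: field_simps)
  then have "(1 - 1 / (real d + 1)) ^ d = 1 / (1 + 1 / real d) ^ d"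
    by (simp add: power_one_over)
  also have "\<dots> \<ge> 1 / exp 1"
    using * by (intro divide_left_mono) (auto intro!: mult_pos_pos zero_less_power add_pos_nonneg)
  finally show ?thesis .
qed

text \<open>By induction on \<open>card S\<close>, the event \<open>A j\<close> has relative
  frequency at most \<open>x\<close> within the outcomes \<open>B S\<close> that avoid all events of
  \<open>S\<close>. Split \<open>S\<close> into neighbours \<open>S1\<close> and the rest
  \<open>S2\<close>. Enlarging \<open>A j \<inter> B S\<close> to \<open>A j \<inter> B S2\<close>
  lets \<open>dep\<close> bound it by \<open>p\<close> times \<open>card (B S2)\<close>, while
  passing from \<open>B S2\<close> to \<open>B S\<close> adds at most \<open>d\<close> events, each
  costing a factor \<open>1 - x\<close>. Independence is replaced by the one-sided bound
  \<open>dep\<close>; this is the lopsided form.\<close>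

lemma lopsided_local_lemma_uniform_weight:
  fixes p x :: real and A :: "'j \<Rightarrow> 'w set" and nb :: "'j \<Rightarrow> 'j set"
  assumes fin: "finite W" "W \<noteq> {}" "finite J"
    and x: "0 \<le> x" "x < 1" and p: "p \<le> x * (1 - x) ^ d"
    and nb: "\<And>j. j \<in> J \<Longrightarrow> finite (nb j)" "\<And>j. j \<in> J \<Longrightarrow> card (nb j - {j}) \<le> d"
    and dep: "\<And>j S. j \<in> J \<Longrightarrow> S \<subseteq> J - nb j \<Longrightarrow>
       real (card (A j \<inter> (W - (\<Union>i\<in>S. A i)))) \<le> p * real (card (W - (\<Union>i\<in>S. A i)))"
  shows "W - (\<Union>j\<in>J. A j) \<noteq> {}"
proof -
  define B where "B S = W - (\<Union>i\<in>S. A i)" for S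
  have finB: "finite (B S)" for S
    unfolding B_def using fin by auto
  have step: "(1 - x) * card (B S) \<le> card (B (insert j S))"
    if "card (A j \<inter> B S) \<le> x * card (B S)" for j S
  proof -
    have "B S = (A j \<inter> B S) \<union> B (insert j S)" "(A j \<inter> B S) \<inter> B (insert j S) = {}"
      by (auto simp: B_def)
    then have "card (B S) = card (A j \<inter> B S) + card (B (insert j S))"
      using card_Un_disjoint[of "A j \<inter> B S" "B (insert j S)"] finB by auto
    then have "real (card (B S)) = card (A j \<inter> B S) + card (B (insert j S))"
      by simp
    then show ?thesis
      using that by (simp add: algebra_simps)
  qed
  have extend: "(1 - x) ^ card T * card (B S) \<le> card (B (S \<union> T))"
    if "finite T" "S \<inter> T = {}"
      "\<And>j T'. j \<in> T \<Longrightarrow> T' \<subseteq> T - {j} \<Longrightarrow> card (A j \<inter> B (S \<union> T')) \<le> x * card (B (S \<union> T'))"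
    for S T
    using that
  proof (induction T rule: finite_induct)
    case (insert j T)
    have "(1 - x) ^ card T * card (B S) \<le> card (B (S \<union> T))"
    proof (rule insert.IH)
      show "S \<inter> T = {}"
        using insert.prems by auto
      fix i T' assume "i \<in> T" "T' \<subseteq> T - {i}"
      then show "card (A i \<inter> B (S \<union> T')) \<le> x * card (B (S \<union> T'))"
        by (intro insert.prems) auto
    qed
    then have "(1 - x) * ((1 - x) ^ card T * card (B S)) \<le> (1 - x) * card (B (S \<union> T))"
      using x by (intro mult_left_mono) auto
    also have "\<dots> \<le> card (B (insert j (S \<union> T)))"
      using insert.prems(2)[of j T] insert.hyps by (intro step) auto
    finally show ?case
      using insert.hyps by (simp add: mult.assoc)
  qed simp
  have main: "card (A j \<inter> B S) \<le> x * card (B S)" if "S \<subseteq> J" "j \<in> J" "j \<notin> S" for j S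
    using that
  proof (induction "card S" arbitrary: j S rule: less_induct)
    case less
    define S1 where "S1 = S \<inter> nb j"
    define S2 where "S2 = S - nb j"
    have S: "S = S2 \<union> S1" "S2 \<inter> S1 = {}"
      by (auto simp: S1_def S2_def)
    have finS: "finite S"
      using less.prems fin finite_subset by auto
    have "card S1 \<le> card (nb j - {j})"
      using less.prems nb by (intro card_mono) (auto simp: S1_def)
    then have cS1: "card S1 \<le> d"
      using nb(2)[of j] less.prems by linarith
    have "(1 - x) ^ d * card (B S2) \<le> (1 - x) ^ card S1 * card (B S2)"
      using x cS1 by (intro mult_right_mono power_decreasing) auto
    also have "\<dots> \<le> card (B (S2 \<union> S1))"
    proof (rule extend)
      fix i T' assume "i \<in> S1" "T' \<subseteq> S1 - {i}"
      then have i: "i \<notin> S2 \<union> T'" "i \<in> S" "S2 \<union> T' \<subseteq> S"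
        using S by auto
      then have "S2 \<union> T' \<subset> S"
        by blast
      then have "card (S2 \<union> T') < card S"
        by (rule psubset_card_mono[OF finS])
      then show "card (A i \<inter> B (S2 \<union> T')) \<le> x * card (B (S2 \<union> T'))"
        using less.hyps[of "S2 \<union> T'" i] i less.prems by (meson order_trans subsetD)
    qed (use finS in \<open>auto simp: S1_def S2_def\<close>)
    finally have le: "(1 - x) ^ d * card (B S2) \<le> card (B S)"
      using S(1) by metis
    have "card (A j \<inter> B S) \<le> card (A j \<inter> B S2)"
      by (intro card_mono) (use fin in \<open>auto simp: B_def S2_def\<close>)
    also have "\<dots> \<le> p * card (B S2)"
      unfolding B_def using less.prems by (intro dep) (auto simp: S2_def)
    also have "\<dots> \<le> (x * (1 - x) ^ d) * card (B S2)"
      using p by (intro mult_right_mono) auto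
    also have "\<dots> \<le> x * card (B S)"
      using le x by (simp add: mult.assoc mult_left_mono)
    finally show ?case
      by simp
  qed
  have "(1 - x) ^ card J * card (B {}) \<le> card (B ({} \<union> J))"
    by (rule extend) (use fin main in auto)
  moreover have "0 < (1 - x) ^ card J * card (B {})"
    using x fin by (auto simp: B_def card_gt_0_iff)
  ultimately have "card (B J) > 0"
    by simp
  then show ?thesis
    by (auto simp: B_def card_gt_0_iff)
qed

text \<open>The weight is \<open>x = 1/m\<close> with \<open>d = m - 1\<close>: here
  \<open>m\<close> counts \<open>j\<close> among its own neighbours, so the condition is the usual e
  p (d + 1) \<le> 1.\<close>

lemma lopsided_local_lemma:
  fixes p :: real and A :: "'j \<Rightarrow> 'w set" and nb :: "'j \<Rightarrow> 'j set"
  assumes fin: "finite W" "W \<noteq> {}" "finite J"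
    and p: "exp 1 * p * real m \<le> 1"
    and nb: "\<And>j. j \<in> J \<Longrightarrow> finite (nb j)" "\<And>j. j \<in> J \<Longrightarrow> j \<in> nb j"
      "\<And>j. j \<in> J \<Longrightarrow> card (nb j) \<le> m"
    and dep: "\<And>j S. j \<in> J \<Longrightarrow> S \<subseteq> J - nb j \<Longrightarrow>
       real (card (A j \<inter> (W - (\<Union>i\<in>S. A i)))) \<le> p * real (card (W - (\<Union>i\<in>S. A i)))"
  shows "W - (\<Union>j\<in>J. A j) \<noteq> {}"
proof (cases "J = {}")
  case False
  then obtain j where j: "j \<in> J"
    by auto
  have "card (nb j) > 0"
    using j nb by (auto simp: card_gt_0_iff)
  then have m: "m > 0"
    using nb(3)[OF j] by simp
  have nb': "card (nb j - {j}) \<le> m - 1" if "j \<in> J" for j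
    using nb[OF that] by (simp add: card_Diff_singleton)
  have pm: "p \<le> 1 / (exp 1 * m)"
    using p m by (simp add: field_simps)
  show ?thesis
  \<comment> \<open>For \<open>m = 1\<close> the weight \<open>1/m\<close> would violate
    \<open>x < 1\<close>; as p \<le> 1/e \<le> 1/2, the weight 1/2 works instead.\<close>
  proof (cases "m = 1")
    case True
    have "p \<le> 1/2 * (1 - 1/2) ^ (m - 1)"
    proof -
      have "exp 1 \<ge> (2::real)"
        using exp_ge_add_one_self[of 1] by simp
      then have "1 / exp 1 \<le> (1/2 :: real)"
        by (intro divide_left_mono) auto
      then show ?thesis
        using order_trans[of p "1 / exp 1" "1/2"] pm True by simp
    qed
    then show ?thesis
      by (intro lopsided_local_lemma_uniform_weight[OF fin _ _ _ nb(1) nb' dep, where x = "1/2"]) auto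
  next
    case False
    have "1 / (exp 1 * m) \<le> 1 / m * (1 - 1 / m) ^ (m - 1)"
      using one_minus_inverse_power_ge_exp[of "m - 1"] m False
      by (simp add: field_simps of_nat_diff)
    then show ?thesis
      using pm m False
      by (intro lopsided_local_lemma_uniform_weight[OF fin _ _ _ nb(1) nb' dep, where x = "1/m"]) auto
  qed
qed (use fin in auto)

subsection \<open>Random injections\<close>

text \<open>The law of total probability: a bound on the conditional probability of \<open>P\<close>
  given each value of \<open>h\<close> holds unconditionally.\<close>

lemma card_le_if_card_fibres_le:
  fixes p :: real
  assumes "finite B"
    and "\<And>w. w \<in> B \<Longrightarrow>
      real (card {u \<in> B. h u = h w \<and> P u}) \<le> p * real (card {u \<in> B. h u = h w})"
  shows "real (card {u \<in> B. P u}) \<le> p * real (card B)"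
proof -
  have fib: "card {u \<in> B. Q u} = (\<Sum>y\<in>h ` B. card {u \<in> B. h u = y \<and> Q u})" for Q
  proof -
    have "{u \<in> B. Q u} = (\<Union>y\<in>h ` B. {u \<in> B. h u = y \<and> Q u})"
      by auto
    then show ?thesis
      using assms(1) by (subst card_UN_disjoint[symmetric]) auto
  qed
  have "real (card {u \<in> B. P u}) = (\<Sum>y\<in>h ` B. real (card {u \<in> B. h u = y \<and> P u}))"
    by (subst fib) simp
  also have "\<dots> \<le> (\<Sum>y\<in>h ` B. p * real (card {u \<in> B. h u = y}))"
    using assms(2) by (intro sum_mono) auto
  also have "\<dots> = p * real (card B)"
    using fib[of "\<lambda>_. True"] by (simp add: sum_distrib_left)
  finally show ?thesis .
qed

lemma card_if_card_fibres_eq: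
  assumes "finite K" "finite Y" "h ` K \<subseteq> Y" "\<And>y. y \<in> Y \<Longrightarrow> card {g \<in> K. h g = y} = c"
  shows "card {g \<in> K. P (h g)} = c * card {y \<in> Y. P y}"
proof -
  have "{g \<in> K. P (h g)} = (\<Union>y\<in>{y \<in> Y. P y}. {g \<in> K. h g = y})"
    using assms(3) by auto
  then have "card {g \<in> K. P (h g)} = (\<Sum>y\<in>{y \<in> Y. P y}. card {g \<in> K. h g = y})"
    using assms(1,2) by (simp only:, intro card_UN_disjoint) auto
  then show ?thesis
    using assms(4) by simp
qed

text \<open>Extensionality makes a member determined by its values on \<open>S\<close>, so that
  counting members is counting injections.\<close>

definition injections :: "'a set \<Rightarrow> 'b set \<Rightarrow> ('a \<Rightarrow> 'b) set" where
  "injections S X = {g \<in> S \<rightarrow>\<^sub>E X. inj_on g S}"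

lemma finite_injections: "finite S \<Longrightarrow> finite X \<Longrightarrow> finite (injections S X)"
  unfolding injections_def by (simp add: finite_PiE)

lemma injections_nonempty:
  assumes "finite S" "finite X" "card S \<le> card X"
  shows "injections S X \<noteq> {}"
proof -
  obtain f where "inj_on f S" "f ` S \<subseteq> X"
    using card_le_inj[OF assms] by blast
  then have "restrict f S \<in> injections S X"
    by (auto simp: injections_def inj_on_def)
  then show ?thesis
    by auto
qed

text \<open>
  Given its values outside \<open>T\<close>, a random injection maps \<open>T\<close> onto a uniformly random set of
  unused values.
\<close>

lemma card_extensions_image:
  fixes g0 :: "'a \<Rightarrow> 'b"
  assumes fin: "finite S" "finite X" and T: "T \<subseteq> S" and g0: "g0 \<in> injections S X"
  defines "K \<equiv> {g \<in> injections S X. \<forall>u\<in>S - T. g u = g0 u}"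
  defines "Y \<equiv> nsets (X - g0 ` (S - T)) (card T)"
  obtains c where "\<And>P. card {g \<in> K. P (g ` T)} = c * card {D \<in> Y. P D}"
proof -
  have finT: "finite T"
    using fin T finite_subset by auto
  have finK: "finite K"
    unfolding K_def using finite_injections[OF fin] by auto
  have finY: "finite Y"
    unfolding Y_def using fin by (intro finite_imp_finite_nsets) auto
  have img: "(\<lambda>g. g ` T) ` K \<subseteq> Y"
  proof safe
    fix g assume "g \<in> K"
    then have g: "g \<in> S \<rightarrow>\<^sub>E X" "inj_on g S" "\<And>u. u \<in> S - T \<Longrightarrow> g u = g0 u"
      by (auto simp: K_def injections_def)
    have "g ` T \<inter> g ` (S - T) = {}"
      using g(2) T by (auto simp: inj_on_def)
    moreover have "g ` (S - T) = g0 ` (S - T)"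
      using g(3) by auto
    ultimately show "g ` T \<in> Y"
      using g T finT by (auto simp: Y_def nsets_def intro!: card_image intro: inj_on_subset)
  qed
  have le: "card {g \<in> K. g ` T = D} \<le> card {g \<in> K. g ` T = D'}" if D: "D \<in> Y" "D' \<in> Y" for D D'
  proof -
    have "finite D" "finite D'" "card D = card D'"
      using D by (auto simp: Y_def nsets_def)
    then obtain s where s: "bij_betw s D D'"
      using finite_same_card_bij by blast
    define t where "t g = (\<lambda>u. if u \<in> T then s (g u) else g u)" for g :: "'a \<Rightarrow> 'b"
    have "t g \<in> {g \<in> K. g ` T = D'}" if "g \<in> K" "g ` T = D" for g
    proof -
      have g: "g \<in> S \<rightarrow>\<^sub>E X" "inj_on g S" "\<And>u. u \<in> S - T \<Longrightarrow> g u = g0 u"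
        using that by (auto simp: K_def injections_def)
      have tT: "t g ` T = D'"
        using that(2) s by (auto simp: t_def bij_betw_def)
      have "inj_on (t g) T"
      proof -
        have "inj_on (s \<circ> g) T"
          using s that(2) g(2) T by (intro comp_inj_on) (auto simp: bij_betw_def intro: inj_on_subset)
        then show ?thesis
          by (auto simp: t_def inj_on_def)
      qed
      moreover have "inj_on (t g) (S - T)"
        using g(2) by (auto simp: t_def inj_on_def)
      moreover have "t g ` (S - T) = g0 ` (S - T)"
        using g(3) by (auto simp: t_def)
      then have "t g ` T \<inter> t g ` (S - T) = {}"
        using tT D by (auto simp: Y_def nsets_def)
      ultimately have "inj_on (t g) (T \<union> (S - T))"
        by (subst inj_on_Un) auto
      then have inj: "inj_on (t g) S"
        using T by (simp add: Un_absorb1)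
      have "t g \<in> S \<rightarrow>\<^sub>E X"
      proof (rule PiE_I)
        fix u assume u: "u \<in> S"
        show "t g u \<in> X"
        proof (cases "u \<in> T")
          case True
          then have "t g u \<in> D'"
            using tT by auto
          then show ?thesis
            using D by (auto simp: Y_def nsets_def)
        qed (use g(1) u in \<open>auto simp: t_def\<close>)
      qed (use g T in \<open>auto simp: t_def\<close>)
      then show ?thesis
        using inj tT g(3) by (auto simp: K_def injections_def t_def)
    qed
    moreover have "inj_on t {g \<in> K. g ` T = D}"
    proof (rule inj_onI)
      fix g g' assume *: "g \<in> {g \<in> K. g ` T = D}" "g' \<in> {g \<in> K. g ` T = D}" "t g = t g'"
      show "g = g'"
      proof
        fix u
        have "t g u = t g' u"
          using * by simp
        moreover have "u \<in> T \<Longrightarrow> g u \<in> D" "u \<in> T \<Longrightarrow> g' u \<in> D"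
          using * by auto
        ultimately show "g u = g' u"
          using s by (auto simp: t_def bij_betw_def inj_on_def split: if_splits)
      qed
    qed
    ultimately show ?thesis
      using finK by (intro card_inj_on_le[of t]) auto
  qed
  define c where "c = card {g \<in> K. g ` T = (SOME D. D \<in> Y)}"
  have c: "card {g \<in> K. g ` T = D} = c" if "D \<in> Y" for D
    unfolding c_def using le[OF that] le[OF _ that] someI[of "\<lambda>D. D \<in> Y", OF that]
    by (intro order_antisym) auto
  show ?thesis
    using card_if_card_fibres_eq[of K Y "\<lambda>g. g ` T", OF finK finY img c] that by blast
qed

lemma card_extensions_avoiding_le:
  fixes q :: real
  assumes fin: "finite S" "finite X" and T: "T \<subseteq> S" and v: "v \<in> S - T"
    and g0: "g0 \<in> injections S X"
    and F: "\<And>x. x \<in> X \<Longrightarrow> real (card {D \<in> nsets (X - {x}) (card T). insert x D \<notin> F})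
      \<le> q * real ((card X - card S + card T) choose card T)"
  defines "K \<equiv> {g \<in> injections S X. \<forall>u\<in>S - T. g u = g0 u}"
  shows "real (card {g \<in> K. g ` insert v T \<notin> F}) \<le> q * real (card K)"
proof -
  define Y where "Y = nsets (X - g0 ` (S - T)) (card T)"
  obtain c where c: "\<And>P. card {g \<in> K. P (g ` T)} = c * card {D \<in> Y. P D}"
    using card_extensions_image[OF fin T g0] unfolding K_def Y_def by blast
  have g0': "g0 ` S \<subseteq> X" "inj_on g0 S"
    using g0 by (auto simp: injections_def)
  have finT: "finite T"
    using fin T finite_subset by auto
  have cS: "card S \<le> card X"
    using card_inj_on_le[OF g0'(2,1) fin(2)] .
  have "card (g0 ` (S - T)) = card S - card T"
    using g0' finT T by (subst card_image) (auto intro: inj_on_subset simp: card_Diff_subset)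
  moreover have "g0 ` (S - T) \<subseteq> X"
    using g0' by auto
  ultimately have "card (X - g0 ` (S - T)) = card X - (card S - card T)"
    using fin by (subst card_Diff_subset) auto
  also have "\<dots> = card X - card S + card T"
    using cS card_mono[OF fin(1) T] by simp
  finally have cY: "card Y = (card X - card S + card T) choose card T"
    by (simp add: Y_def)
  have "{g \<in> K. g ` insert v T \<notin> F} = {g \<in> K. insert (g0 v) (g ` T) \<notin> F}"
    using v by (auto simp: K_def)
  then have "card {g \<in> K. g ` insert v T \<notin> F} = c * card {D \<in> Y. insert (g0 v) D \<notin> F}"
    using c[of "\<lambda>D. insert (g0 v) D \<notin> F"] by simp
  also have "\<dots> \<le> c * card {D \<in> nsets (X - {g0 v}) (card T). insert (g0 v) D \<notin> F}"
  proof (intro mult_left_mono card_mono)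
    show "finite {D \<in> nsets (X - {g0 v}) (card T). insert (g0 v) D \<notin> F}"
      using finite_imp_finite_nsets[of "X - {g0 v}" "card T"] fin by simp
    have "Y \<subseteq> nsets (X - {g0 v}) (card T)"
      unfolding Y_def using v by (intro nsets_mono) auto
    then show "{D \<in> Y. insert (g0 v) D \<notin> F} \<subseteq> {D \<in> nsets (X - {g0 v}) (card T). insert (g0 v) D \<notin> F}"
      by auto
  qed simp
  finally have "real (card {g \<in> K. g ` insert v T \<notin> F})
      \<le> real c * real (card {D \<in> nsets (X - {g0 v}) (card T). insert (g0 v) D \<notin> F})"
    by (simp flip: of_nat_mult)
  also have "\<dots> \<le> real c * (q * real (card Y))"
    unfolding cY using F[of "g0 v"] g0'(1) v by (simp add: image_subset_iff mult_left_mono)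
  also have "\<dots> = q * real (card K)"
    using c[of "\<lambda>_. True"] by simp
  finally show ?thesis .
qed

text \<open>Condition on the values of all injections outside \<open>T\<close>, recorded by
  \<open>h\<close>. The injections remain independent, and each of the \<open>k\<close> colours in
  the list of \<open>insert v T\<close> contributes a factor \<open>q\<close>.\<close>

lemma card_families_avoiding_le:
  fixes q :: real and I :: "'i set" and L :: "'a set \<Rightarrow> 'i set"
  assumes fin: "finite S" "finite X" "finite I" and T: "T \<subseteq> S" and v: "v \<in> S - T"
    and LI: "L (insert v T) \<subseteq> I" "card (L (insert v T)) = k"
    and q: "q \<ge> 0"
    and F: "\<And>x. x \<in> X \<Longrightarrow> real (card {D \<in> nsets (X - {x}) (card T). insert x D \<notin> F})
      \<le> q * real ((card X - card S + card T) choose card T)"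
    and M: "\<And>e. e \<in> M \<Longrightarrow> e \<subseteq> S - T \<and> L e \<subseteq> I"
  defines "W \<equiv> I \<rightarrow>\<^sub>E injections S X"
  defines "A \<equiv> \<lambda>e. {w \<in> W. \<forall>i\<in>L e. w i ` e \<notin> F}"
  shows "real (card (A (insert v T) \<inter> (W - (\<Union>e\<in>M. A e)))) \<le> q ^ k * real (card (W - (\<Union>e\<in>M. A e)))"
proof -
  define B where "B = W - (\<Union>e\<in>M. A e)"
  define h where "h w = (\<lambda>i\<in>I. restrict (w i) (S - T))" for w :: "'i \<Rightarrow> 'a \<Rightarrow> 'b"
  have h_eq_iff: "h w = h w' \<longleftrightarrow> (\<forall>i\<in>I. \<forall>u\<in>S - T. w i u = w' i u)" for w w'
    unfolding h_def by (auto simp: fun_eq_iff restrict_def)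
  have "finite W"
    unfolding W_def using fin by (intro finite_PiE finite_injections) auto
  then have finB: "finite B"
    by (simp add: B_def)
  have "real (card {u \<in> B. h u = h w \<and> (\<forall>i\<in>L (insert v T). u i ` insert v T \<notin> F)})
      \<le> q ^ k * real (card {u \<in> B. h u = h w})" if w: "w \<in> B" for w
  proof -
    \<comment> \<open>The edges in \<open>M\<close> are disjoint from \<open>T\<close>, so
      \<open>h\<close> already decides their events: a fibre of \<open>h\<close> that meets
      \<open>B\<close> lies entirely in \<open>B\<close>.\<close>
    have sat: "u \<in> B \<longleftrightarrow> u \<in> W" if "h u = h w" for u
    proof -
      have "u i ` e = w i ` e" if "e \<in> M" "i \<in> L e" for e i
        using M[OF that(1)] that(2) \<open>h u = h w\<close> unfolding h_eq_iff by (intro image_cong) blast+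
      then show ?thesis
        using w unfolding B_def A_def by auto
    qed
    define K where "K i = {g \<in> injections S X. \<forall>u\<in>S - T. g u = w i u}" for i
    have wi: "w i \<in> injections S X" if "i \<in> I" for i
      using w that by (auto simp: B_def W_def)
    have 1: "{u \<in> B. h u = h w} = Pi\<^sub>E I K"
    proof -
      have "{u \<in> B. h u = h w} = {u \<in> W. h u = h w}"
        using sat by auto
      also have "\<dots> = Pi\<^sub>E I K"
        unfolding h_eq_iff W_def K_def by (auto simp: PiE_iff extensional_def)
      finally show ?thesis .
    qed
    \<comment> \<open>Being bad is a separate restriction on each coordinate in the list, so the bad
      part of the fibre is again a product.\<close>
    have 2: "{u \<in> B. h u = h w \<and> (\<forall>i\<in>L (insert v T). u i ` insert v T \<notin> F)} =
       Pi\<^sub>E I (\<lambda>i. if i \<in> L (insert v T) then {g \<in> K i. g ` insert v T \<notin> F} else K i)"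
      (is "?lhs = Pi\<^sub>E I ?K'")
    proof -
      have "?lhs = {u \<in> Pi\<^sub>E I K. \<forall>i\<in>L (insert v T). u i ` insert v T \<notin> F}"
        unfolding 1[symmetric] by auto
      also have "\<dots> = Pi\<^sub>E I ?K'"
      proof (rule set_eqI)
        fix u
        show "u \<in> {u \<in> Pi\<^sub>E I K. \<forall>i\<in>L (insert v T). u i ` insert v T \<notin> F} \<longleftrightarrow> u \<in> Pi\<^sub>E I ?K'"
          using LI(1) by (auto simp only: PiE_iff mem_Collect_eq split: if_splits)
      qed
      finally show ?thesis .
    qed
    have "real (card (Pi\<^sub>E I ?K')) = (\<Prod>i\<in>I. real (card (?K' i)))"
      using fin by (simp add: card_PiE)
    also have "\<dots> \<le> (\<Prod>i\<in>I. (if i \<in> L (insert v T) then q else 1) * real (card (K i)))"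
    proof (rule prod_mono, safe)
      fix i assume "i \<in> I"
      then show "real (card (?K' i)) \<le> (if i \<in> L (insert v T) then q else 1) * real (card (K i))"
        using card_extensions_avoiding_le[OF fin(1,2) T v wi F] by (auto simp: K_def)
    qed simp
    also have "\<dots> = q ^ k * real (card (Pi\<^sub>E I K))"
    proof -
      have "(\<Prod>i\<in>I. if i \<in> L (insert v T) then q else 1) = q ^ k"
        using LI fin by (simp add: prod.If_cases Int_absorb1)
      then show ?thesis
        using fin by (simp add: card_PiE prod.distrib)
    qed
    finally show ?thesis
      unfolding 1 2 .
  qed
  then have "real (card {u \<in> B. \<forall>i\<in>L (insert v T). u i ` insert v T \<notin> F}) \<le> q ^ k * real (card B)"
    by (rule card_le_if_card_fibres_le[OF finB])
  moreover have "A (insert v T) \<inter> B = {u \<in> B. \<forall>i\<in>L (insert v T). u i ` insert v T \<notin> F}"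
    by (auto simp: A_def B_def)
  ultimately show ?thesis
    by (simp add: B_def)
qed

subsection \<open>Turan density and minimum degree\<close>

lemma not_contains_copy_empty: "E \<noteq> {} \<Longrightarrow> \<not> contains_copy V E W {}"
  by (auto simp: contains_copy_def)

lemma contains_copy_mono:
  assumes "W \<subseteq> W'" "F \<subseteq> F'" "contains_copy V E W F"
  shows "contains_copy V E W' F'"
proof -
  obtain f where "inj_on f V" "f ` V \<subseteq> W" "\<forall>e\<in>E. f ` e \<in> F"
    using assms(3) unfolding contains_copy_def by (elim exE conjE)
  then show ?thesis
    unfolding contains_copy_def using assms(1,2) by (intro exI[of _ f] conjI) auto
qed

text \<open>As \<open>E\<close> has an edge, the edgeless graph is \<open>H\<close>-free, and the
  maximum in \<open>ex_number\<close> is over a nonempty finite set.\<close>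

lemma ex_number_attained:
  assumes "E \<noteq> {}"
  shows "\<exists>F. F \<subseteq> nsets {..<n} r \<and> \<not> contains_copy V E {..<n} F \<and> card F = ex_number r V E n"
    and "F \<subseteq> nsets {..<n} r \<Longrightarrow> \<not> contains_copy V E {..<n} F \<Longrightarrow> card F \<le> ex_number r V E n"
proof -
  let ?M = "{card F | F. F \<subseteq> nsets {..<n} r \<and> \<not> contains_copy V E {..<n} F}"
  have "?M \<subseteq> card ` Pow (nsets {..<n} r)"
    by auto
  then have fin: "finite ?M"
    by (rule finite_subset) (simp add: finite_imp_finite_nsets)
  moreover have "?M \<noteq> {}"
    using not_contains_copy_empty[OF assms, of V "{..<n}"] by blast
  ultimately have "Max ?M \<in> ?M"
    by (rule Max_in)
  then show "\<exists>F. F \<subseteq> nsets {..<n} r \<and> \<not> contains_copy V E {..<n} F \<and> card F = ex_number r V E n"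
    unfolding ex_number_def by auto
  show "card F \<le> ex_number r V E n" if "F \<subseteq> nsets {..<n} r" "\<not> contains_copy V E {..<n} F"
    unfolding ex_number_def using that by (intro Max_ge[OF fin]) auto
qed

lemma contains_copy_inj_image:
  assumes "inj_on f W" "\<And>e. e \<in> F \<Longrightarrow> e \<subseteq> W" "\<Union>E \<subseteq> V" "contains_copy V E (f ` W) ((`) f ` F)"
  shows "contains_copy V E W F"
proof -
  obtain g where g: "inj_on g V" "g ` V \<subseteq> f ` W" "\<And>e. e \<in> E \<Longrightarrow> g ` e \<in> (`) f ` F"
    using assms(4) by (auto simp: contains_copy_def)
  define h where "h = inv_into W f \<circ> g"
  have "inj_on h V"
    unfolding h_def using g by (intro comp_inj_on inj_on_inv_into) auto
  moreover have "h ` V \<subseteq> W"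
    using g(2) by (auto simp: h_def intro!: inv_into_into)
  moreover have "h ` e \<in> F" if e: "e \<in> E" for e
  proof -
    obtain e' where e': "e' \<in> F" "g ` e = f ` e'"
      using g(3)[OF e] by auto
    have "h ` e = inv_into W f ` f ` e'"
      unfolding h_def image_comp[symmetric] e'(2) ..
    also have "\<dots> = e'"
      using assms(1,2) e' by (simp add: inv_into_image_cancel)
    finally show ?thesis
      using e' by simp
  qed
  ultimately show ?thesis
    by (auto simp: contains_copy_def)
qed

text \<open>Relabelling transfers the bound from \<open>{..<n}\<close> to any \<open>n\<close>-set;
  deleting a vertex leaves a set that need not be an initial segment.\<close>

lemma card_le_ex_number:
  assumes "E \<noteq> {}" "\<Union>E \<subseteq> V" "finite W" "card W = n"
    and F: "F \<subseteq> nsets W r" "\<not> contains_copy V E W F"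
  shows "card F \<le> ex_number r V E n"
proof -
  obtain f where f: "bij_betw f W {..<n}"
    using finite_same_card_bij[of W "{..<n}"] assms by auto
  have inj: "inj_on f W" "f ` W = {..<n}"
    using f by (auto simp: bij_betw_def)
  have bij: "bij_betw ((`) f) (nsets W r) (nsets {..<n} r)"
    using bij_betw_nsets[OF f] .
  have "card ((`) f ` F) = card F"
    using F bij by (intro card_image) (auto simp: bij_betw_def intro: inj_on_subset)
  moreover have "(`) f ` F \<subseteq> nsets {..<n} r"
    using F bij by (auto simp: bij_betw_def)
  moreover have "\<not> contains_copy V E {..<n} ((`) f ` F)"
    using contains_copy_inj_image[OF inj(1), of F E V] F assms(2) inj(2) by (auto simp: nsets_def)
  ultimately show ?thesis
    by (metis ex_number_attained(2)[OF assms(1)])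
qed

lemma card_avoiding_vertex_le_ex_number:
  assumes "E \<noteq> {}" "\<Union>E \<subseteq> V"
    and F: "F \<subseteq> nsets {..<Suc n} r" "\<not> contains_copy V E {..<Suc n} F" and v: "v < Suc n"
  shows "card {e \<in> F. v \<notin> e} \<le> ex_number r V E n"
proof (rule card_le_ex_number[OF assms(1,2)])
  show "card ({..<Suc n} - {v}) = n"
    using v by simp
  show "{e \<in> F. v \<notin> e} \<subseteq> nsets ({..<Suc n} - {v}) r"
    using F(1) by (auto simp: nsets_def)
  show "\<not> contains_copy V E ({..<Suc n} - {v}) {e \<in> F. v \<notin> e}"
    using F(2) contains_copy_mono[of "{..<Suc n} - {v}" "{..<Suc n}" "{e \<in> F. v \<notin> e}" F] by auto
qed simp

text \<open>Averaging over vertex deletions: an extremal graph on \<open>Suc n\<close> vertices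
  leaves an \<open>H\<close>-free graph on \<open>n\<close> vertices for each deleted vertex, and
  each edge survives \<open>Suc n - r\<close> of the deletions.\<close>

lemma ex_number_Suc_mult_le:
  assumes "E \<noteq> {}" "\<Union>E \<subseteq> V"
  shows "(Suc n - r) * ex_number r V E (Suc n) \<le> Suc n * ex_number r V E n"
proof -
  obtain F where F: "F \<subseteq> nsets {..<Suc n} r" "\<not> contains_copy V E {..<Suc n} F"
    "card F = ex_number r V E (Suc n)"
    using ex_number_attained(1)[OF assms(1)] by metis
  have finF: "finite F"
    using F(1) finite_imp_finite_nsets finite_subset by blast
  have eq: "(\<Sum>v<Suc n. card {e \<in> F. v \<notin> e}) = (Suc n - r) * card F"
  proof (rule sum_multicount)
    show "\<forall>e\<in>F. card {v \<in> {..<Suc n}. v \<notin> e} = Suc n - r"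
    proof
      fix e assume "e \<in> F"
      then have "e \<subseteq> {..<Suc n}" "finite e" "card e = r"
        using F by (auto simp: nsets_def)
      moreover have "{v \<in> {..<Suc n}. v \<notin> e} = {..<Suc n} - e"
        by auto
      ultimately show "card {v \<in> {..<Suc n}. v \<notin> e} = Suc n - r"
        by (simp add: card_Diff_subset)
    qed
  qed (use finF in auto)
  have "(\<Sum>v<Suc n. card {e \<in> F. v \<notin> e}) \<le> (\<Sum>v<Suc n. ex_number r V E n)"
    using card_avoiding_vertex_le_ex_number[OF assms F(1,2)] by (intro sum_mono) auto
  then show ?thesis
    unfolding eq F(3) by simp
qed

lemma ex_number_le_binomial:
  assumes "E \<noteq> {}"
  shows "ex_number r V E n \<le> n choose r"
proof -
  obtain F where "F \<subseteq> nsets {..<n} r" "card F = ex_number r V E n"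
    using ex_number_attained(1)[OF assms] by metis
  then show ?thesis
    using card_mono[of "nsets {..<n} r" F] by (simp add: finite_imp_finite_nsets)
qed

text \<open>The averaging inequality makes the densities nonincreasing from n = r on. They are
  nonnegative, hence converge, and the \<open>lim\<close> in the definition is a genuine
  limit.\<close>

lemma turan_density_LIMSEQ:
  assumes "E \<noteq> {}" "\<Union>E \<subseteq> V"
  shows "(\<lambda>n. real (ex_number r V E n) / real (n choose r)) \<longlonglongrightarrow> turan_density r V E"
proof -
  define X where "X n = real (ex_number r V E n) / real (n choose r)" for n
  have step: "X (Suc n) \<le> X n" if n: "n \<ge> r" for n
  proof -
    let ?a = "ex_number r V E"
    have "(Suc n - r) * (?a (Suc n) * (n choose r)) \<le> Suc n * ?a n * (n choose r)"
      using ex_number_Suc_mult_le[OF assms, of n r] by (metis mult.assoc mult_le_mono1)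
    also have "\<dots> = (Suc n - r) * (?a n * (Suc n choose r))"
      using binomial_absorb_comp[of "Suc n" r] by (metis diff_Suc_1 mult.assoc mult.commute)
    finally have "?a (Suc n) * (n choose r) \<le> ?a n * (Suc n choose r)"
      using n by (subst (asm) mult_le_cancel1) simp
    then have "real (?a (Suc n)) * real (n choose r) \<le> real (?a n) * real (Suc n choose r)"
      by (metis of_nat_le_iff of_nat_mult)
    then show ?thesis
      using n unfolding X_def by (simp add: divide_le_eq le_divide_eq mult.commute)
  qed
  have "decseq (\<lambda>n. X (n + r))"
    using step by (intro decseq_SucI) auto
  moreover have "\<forall>n. 0 \<le> X (n + r)"
    by (simp add: X_def)
  ultimately obtain l where "(\<lambda>n. X (n + r)) \<longlonglongrightarrow> l"
    using decseq_convergent by metis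
  then have "X \<longlonglongrightarrow> l"
    by (rule LIMSEQ_offset)
  moreover from this have "turan_density r V E = l"
    unfolding turan_density_def X_def by (rule limI)
  ultimately show ?thesis
    by (simp add: X_def[abs_def])
qed

lemma turan_density_le_1:
  assumes "E \<noteq> {}" "\<Union>E \<subseteq> V"
  shows "turan_density r V E \<le> 1"
proof (rule LIMSEQ_le_const2[OF turan_density_LIMSEQ[OF assms]])
  have "real (ex_number r V E n) / real (n choose r) \<le> 1" for n
    using ex_number_le_binomial[OF assms(1), of r V n] by (auto simp: divide_le_eq_1)
  then show "\<exists>N. \<forall>n\<ge>N. real (ex_number r V E n) / real (n choose r) \<le> 1"
    by blast
qed

text \<open>A linear lower bound suffices: by Pascal's rule the coefficient grows by at least 1 in
  each step once n \<ge> r.\<close>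

lemma filterlim_binomial_at_top:
  assumes "r > 0"
  shows "filterlim (\<lambda>n. real (n choose r)) at_top at_top"
proof (rule filterlim_at_top_mono)
  show "filterlim (\<lambda>n. real n - real r) at_top at_top"
    using filterlim_tendsto_add_at_top[OF tendsto_const[of "- real r"] filterlim_real_sequentially]
    by (simp add: algebra_simps)
  have "n \<le> r + (n choose r)" for n
  proof (induction n)
    case (Suc n)
    show ?case
    proof (cases "Suc n \<le> r")
      case False
      then have "n choose (r - 1) > 0"
        by (simp add: zero_less_binomial_iff)
      moreover have "Suc n choose r = (n choose r) + (n choose (r - 1))"
        using assms by (cases r) auto
      ultimately show ?thesis
        using Suc by linarith
    qed simp
  qed simp
  then show "\<forall>\<^sub>F n in at_top. real n - real r \<le> real (n choose r)"
    by (intro always_eventually allI) (metis of_nat_add of_nat_le_iff diff_le_eq add.commute)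
qed

text \<open>
  If every large \<open>H\<close>-free graph had a vertex of relative degree below \<open>a\<close>, deleting such vertices
  one after another would bound the density by \<open>a\<close>.
\<close>

lemma exists_large_min_degree:
  assumes "E \<noteq> {}" "\<Union>E \<subseteq> V" "r > 0" and a: "a < turan_density r V E"
  obtains n F where "n \<ge> n0" "F \<subseteq> nsets {..<Suc n} r" "\<not> contains_copy V E {..<Suc n} F"
    "\<And>v. v < Suc n \<Longrightarrow> a * real (n choose (r - 1)) \<le> real (card {e \<in> F. v \<in> e})"
proof (rule ccontr)
  assume contr: "\<not> thesis"
  note witness = that
  let ?x = "ex_number r V E"
  \<comment> \<open>\<open>Z\<close> is the excess over density \<open>a\<close>. Deleting a vertex
    of low degree loses fewer than \<open>a * (n choose (r - 1))\<close> edges, and by Pascal's rule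
    this is the change of the subtracted term; so \<open>Z\<close> does not increase from
    \<open>n0\<close> on.\<close>
  define Z where "Z n = real (?x n) - a * real (n choose r)" for n
  have step: "Z (Suc n) \<le> Z n" if n: "n \<ge> n0" for n
  proof -
    obtain F where F: "F \<subseteq> nsets {..<Suc n} r" "\<not> contains_copy V E {..<Suc n} F"
      "card F = ?x (Suc n)"
      using ex_number_attained(1)[OF assms(1)] by metis
    have finF: "finite F"
      using F(1) finite_imp_finite_nsets finite_subset by blast
    obtain v where v: "v < Suc n" "real (card {e \<in> F. v \<in> e}) < a * real (n choose (r - 1))"
      using witness[OF n F(1,2)] contr by force
    have "F = {e \<in> F. v \<in> e} \<union> {e \<in> F. v \<notin> e}"
      by auto
    then have "card F = card {e \<in> F. v \<in> e} + card {e \<in> F. v \<notin> e}"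
      using finF by (subst card_Un_disjoint[symmetric]) auto
    moreover have "card {e \<in> F. v \<notin> e} \<le> ?x n"
      using card_avoiding_vertex_le_ex_number[OF assms(1,2) F(1,2) v(1)] .
    ultimately have "real (?x (Suc n)) \<le> a * real (n choose (r - 1)) + real (?x n)"
      using v(2) F(3) by linarith
    moreover have "Suc n choose r = (n choose r) + (n choose (r - 1))"
      using assms(3) by (cases r) auto
    ultimately show ?thesis
      by (simp add: Z_def algebra_simps)
  qed
  have Z: "Z n \<le> Z n0" if "n \<ge> n0" for n
    using that by (induction n rule: dec_induct) (auto intro: order_trans[OF step])
  have "turan_density r V E \<le> a"
  proof (rule tendsto_le[OF _ _ turan_density_LIMSEQ[OF assms(1,2)]])
    show "(\<lambda>n. a + Z n0 / real (n choose r)) \<longlonglongrightarrow> a"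
      using tendsto_add[OF tendsto_const tendsto_divide_0[OF tendsto_const
            filterlim_at_top_imp_at_infinity[OF filterlim_binomial_at_top[OF assms(3)]]]]
      by simp
    show "\<forall>\<^sub>F n in sequentially. real (?x n) / real (n choose r) \<le> a + Z n0 / real (n choose r)"
      using eventually_ge_at_top[of "max n0 r"]
    proof eventually_elim
      case (elim n)
      then have "real (?x n) \<le> a * real (n choose r) + Z n0"
        using Z[of n] by (simp add: Z_def)
      moreover have "real (n choose r) > 0"
        using elim by simp
      ultimately show ?case
        by (simp add: field_simps)
    qed
  qed simp
  then show False
    using a by simp
qed

section \<open>Comparing binomial coefficients with powers\<close>

text \<open>The right-hand side is the product (b + 1) ... (b + m), whose factors are all at least b
  + 1.\<close>

lemma power_le_fact_mult_binomial: "(b + 1) ^ m \<le> fact m * ((b + m) choose m)"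
proof (induction m)
  case (Suc m)
  have "(b + 1) ^ Suc m \<le> (b + m + 1) * (fact m * ((b + m) choose m))"
    using mult_le_mono[OF _ Suc, of "b + 1" "b + m + 1"] by simp
  also have "\<dots> = fact (Suc m) * ((b + Suc m) choose Suc m)"
  proof -
    have "fact (Suc m) * ((b + Suc m) choose Suc m) = fact m * (Suc m * (Suc (b + m) choose Suc m))"
      by (simp add: algebra_simps)
    also have "\<dots> = fact m * (Suc (b + m) * ((b + m) choose m))"
      by (simp only: Suc_times_binomial)
    finally show ?thesis
      by (simp add: mult.left_commute)
  qed
  finally show ?case .
qed simp

text \<open>Both coefficients are asymptotic to N^m / m!, so the gap between \<open>s\<close> and
  \<open>q\<close> absorbs the fixed shift \<open>c\<close>.\<close>

lemma eventually_binomial_shift_le: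
  fixes s q :: real
  assumes "0 \<le> s" "s < q"
  shows "\<forall>\<^sub>F N in sequentially. s * real (N choose m) \<le> q * real ((N - c + m) choose m)"
proof -
  have "(\<lambda>N. q * (1 - real c * (1 / real N)) ^ m) \<longlonglongrightarrow> q * (1 - real c * 0) ^ m"
    by (intro tendsto_intros lim_1_over_n)
  then have "(\<lambda>N. q * (1 - real c * (1 / real N)) ^ m) \<longlonglongrightarrow> q"
    by simp
  then have "\<forall>\<^sub>F N in sequentially. s < q * (1 - real c * (1 / real N)) ^ m"
    using assms by (intro order_tendstoD)
  then show ?thesis
    using eventually_gt_at_top[of c]
  proof eventually_elim
    case (elim N)
    then have N: "real N > 0"
      by simp
    have "fact m * (s * real (N choose m)) \<le> s * real N ^ m"
    proof -
      have "real ((N choose m) * fact m) \<le> real (N ^ m)"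
        by (intro of_nat_mono binomial_fact_pow)
      then show ?thesis
        using mult_left_mono[OF _ assms(1)] by (fastforce simp: ac_simps)
    qed
    also have "\<dots> \<le> q * (1 - real c * (1 / real N)) ^ m * real N ^ m"
      using elim by (intro mult_right_mono) auto
    also have "\<dots> = q * real (N - c) ^ m"
    proof -
      have "(1 - real c * (1 / real N)) * real N = real (N - c)"
        using elim N by (simp add: field_simps of_nat_diff)
      then show ?thesis
        by (metis mult.assoc power_mult_distrib)
    qed
    also have "\<dots> \<le> q * real (N - c + 1) ^ m"
      using assms by (intro mult_left_mono power_mono) auto
    also have "\<dots> \<le> q * (fact m * real ((N - c + m) choose m))"
    proof (rule mult_left_mono)
      have "real ((N - c + 1) ^ m) \<le> real (fact m * ((N - c + m) choose m))"
        by (intro of_nat_mono power_le_fact_mult_binomial)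
      then show "real (N - c + 1) ^ m \<le> fact m * real ((N - c + m) choose m)"
        by simp
    qed (use assms in simp)
    finally have "fact m * (s * real (N choose m)) \<le> fact m * (q * real ((N - c + m) choose m))"
      by (simp add: ac_simps)
    then show ?case
      by (simp only: mult_le_cancel_left_pos[OF fact_gt_zero])
  qed
qed

subsection \<open>The list Ramsey number\<close>

lemma card_link:
  assumes "F \<subseteq> nsets X r" "x \<in> X" "r > 0"
  shows "card {e \<in> F. x \<in> e} = card {D \<in> nsets (X - {x}) (r - 1). insert x D \<in> F}"
proof (rule bij_betw_same_card[symmetric])
  show "bij_betw (insert x) {D \<in> nsets (X - {x}) (r - 1). insert x D \<in> F} {e \<in> F. x \<in> e}"
  proof (rule bij_betw_byWitness[where f' = "\<lambda>e. e - {x}"])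
    show "(\<lambda>e. e - {x}) ` {e \<in> F. x \<in> e} \<subseteq> {D \<in> nsets (X - {x}) (r - 1). insert x D \<in> F}"
    proof safe
      fix e assume "e \<in> F" "x \<in> e"
      then show "e - {x} \<in> nsets (X - {x}) (r - 1)" "insert x (e - {x}) \<in> F"
        using assms by (auto simp: nsets_def insert_absorb)
    qed
  qed (auto simp: nsets_def)
qed

lemma card_nsets_containing:
  assumes "x \<in> X" "finite X" "r > 0"
  shows "card {e \<in> nsets X r. x \<in> e} = (card X - 1) choose (r - 1)"
proof -
  have "{D \<in> nsets (X - {x}) (r - 1). insert x D \<in> nsets X r} = nsets (X - {x}) (r - 1)"
    using assms by (auto simp: nsets_def subset_Diff_insert)
  then show ?thesis
    using card_link[OF subset_refl assms(1,3)] assms by simp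
qed

text \<open>This turns a lower bound on degrees into an upper bound on the sets that fail to
  complete a vertex to an edge, the form needed for the random injections.\<close>

lemma card_nonlink:
  assumes "F \<subseteq> nsets X r" "x \<in> X" "r > 0" "finite X"
  shows "real (card {D \<in> nsets (X - {x}) (r - 1). insert x D \<notin> F})
    = real ((card X - 1) choose (r - 1)) - real (card {e \<in> F. x \<in> e})"
proof -
  let ?Y = "nsets (X - {x}) (r - 1)"
  have fin: "finite ?Y"
    using assms by (intro finite_imp_finite_nsets) auto
  have "?Y = {D \<in> ?Y. insert x D \<notin> F} \<union> {D \<in> ?Y. insert x D \<in> F}"
    by auto
  then have "card ?Y = card {D \<in> ?Y. insert x D \<notin> F} + card {D \<in> ?Y. insert x D \<in> F}"
    using fin by (subst card_Un_disjoint[symmetric]) auto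
  moreover have "card ?Y = (card X - 1) choose (r - 1)"
    using assms by simp
  ultimately show ?thesis
    using card_link[OF assms(1,2,3)] by simp
qed

text \<open>The local lemma with p = \<open>q ^ k\<close> and m =
  \<open>(r - 1) * ((n - 1) choose (r - 1))\<close> yields a family \<open>w\<close> under which
  every edge has a good colour. The map \<open>w i\<close> would carry a copy of \<open>H\<close> in
  colour \<open>i\<close> to a copy in \<open>F\<close>.\<close>

lemma exists_list_coloring_without_monochromatic_copy:
  fixes q :: real
  assumes r: "r \<ge> 2" and E: "E \<noteq> {}" "\<Union>E \<subseteq> V"
    and L: "L \<in> nsets {..<n} r \<rightarrow> nsets UNIV k"
    and q: "q \<ge> 0" "exp 1 * q ^ k * real ((r - 1) * ((n - 1) choose (r - 1))) \<le> 1"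
    and N: "n \<le> N"
    and free: "\<not> contains_copy V E {..<N} F"
    and F: "\<And>x. x < N \<Longrightarrow> real (card {D \<in> nsets ({..<N} - {x}) (r - 1). insert x D \<notin> F})
      \<le> q * real ((N - n + (r - 1)) choose (r - 1))"
  obtains c where "list_coloring r n L c" "\<not> monochromatic_copy r V E n c"
proof -
  define J where "J = nsets {..<n} r"
  define I where "I = (\<Union>e\<in>J. L e)"
  define W where "W = I \<rightarrow>\<^sub>E injections {..<n} {..<N}"
  define A where "A e = {w \<in> W. \<forall>i\<in>L e. w i ` e \<notin> F}" for e
  \<comment> \<open>\<open>Min e\<close> serves as the vertex whose images stay fixed. As r \<ge> 2,
    \<open>e - {Min e}\<close> is nonempty, which makes \<open>e\<close> a neighbour of
    itself.\<close>
  define nb where "nb e = {f \<in> J. f \<inter> (e - {Min e}) \<noteq> {}}" for e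
  have J: "finite e" "card e = r" "e \<subseteq> {..<n}" "finite (L e)" "card (L e) = k" "Min e \<in> e"
    if "e \<in> J" for e
  proof -
    show e: "finite e" "card e = r" "e \<subseteq> {..<n}"
      using that by (auto simp: J_def nsets_def)
    have "L e \<in> nsets UNIV k"
      using L that by (auto simp: J_def)
    then show "finite (L e)" "card (L e) = k"
      by (auto simp: nsets_def)
    have "e \<noteq> {}"
      using e r by auto
    then show "Min e \<in> e"
      using e by simp
  qed
  have finJ: "finite J"
    unfolding J_def by (simp add: finite_imp_finite_nsets)
  have finI: "finite I"
    unfolding I_def using finJ J(4) by auto
  have "W - (\<Union>e\<in>J. A e) \<noteq> {}"
  proof (rule lopsided_local_lemma[OF _ _ finJ q(2)])
    show "finite W"
      unfolding W_def using finI by (intro finite_PiE finite_injections) auto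
    show "W \<noteq> {}"
      unfolding W_def using injections_nonempty[of "{..<n}" "{..<N}"] N by (auto simp: PiE_eq_empty_iff)
    fix e assume e: "e \<in> J"
    define T where "T = e - {Min e}"
    have T: "T \<subseteq> {..<n}" "card T = r - 1" "insert (Min e) T = e" "Min e \<in> {..<n} - T" "finite T"
      using J[OF e] by (auto simp: T_def)
    show "finite (nb e)"
      unfolding nb_def using finJ by auto
    have "T \<noteq> {}"
      using T(2) r by auto
    then show "e \<in> nb e"
      unfolding nb_def T_def using e by auto
    have "card (nb e) \<le> card (\<Union>u\<in>T. {f \<in> J. u \<in> f})"
      using finJ T by (intro card_mono) (auto simp: nb_def T_def)
    also have "\<dots> \<le> (\<Sum>u\<in>T. card {f \<in> J. u \<in> f})"
      by (intro card_UN_le T)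
    also have "\<dots> = (\<Sum>u\<in>T. (n - 1) choose (r - 1))"
      using T(1) r unfolding J_def by (intro sum.cong refl) (subst card_nsets_containing, auto)
    finally show "card (nb e) \<le> (r - 1) * ((n - 1) choose (r - 1))"
      using T by simp
    fix S assume S: "S \<subseteq> J - nb e"
    have "real (card (A (insert (Min e) T) \<inter> (W - (\<Union>i\<in>S. A i))))
        \<le> q ^ k * real (card (W - (\<Union>i\<in>S. A i)))"
      unfolding A_def W_def
    proof (rule card_families_avoiding_le)
      show "L (insert (Min e) T) \<subseteq> I" "card (L (insert (Min e) T)) = k"
        using T(3) e J by (auto simp: I_def)
      show "real (card {D \<in> nsets ({..<N} - {x}) (card T). insert x D \<notin> F})
          \<le> q * real ((card {..<N} - card {..<n} + card T) choose card T)" if "x \<in> {..<N}" for x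
        using F[of x] that T(2) by simp
      show "f \<subseteq> {..<n} - T \<and> L f \<subseteq> I" if "f \<in> S" for f
      proof -
        have "f \<in> J" "f \<inter> T = {}"
          using that S by (auto simp: nb_def T_def)
        then show ?thesis
          using J(3)[of f] by (auto simp: I_def)
      qed
    qed (use finI T q in auto)
    then show "real (card (A e \<inter> (W - (\<Union>i\<in>S. A i)))) \<le> q ^ k * real (card (W - (\<Union>i\<in>S. A i)))"
      using T(3) by simp
  qed
  then obtain w where "w \<in> W" "\<And>e. e \<in> J \<Longrightarrow> w \<notin> A e"
    by blast
  then have w: "w \<in> W" "\<And>e. e \<in> J \<Longrightarrow> \<exists>i\<in>L e. w i ` e \<in> F"
    by (auto simp: A_def)
  then obtain c where c: "\<And>e. e \<in> J \<Longrightarrow> c e \<in> L e \<and> w (c e) ` e \<in> F"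
    by metis
  have "\<not> monochromatic_copy r V E n c"
  proof
    assume "monochromatic_copy r V E n c"
    then obtain i f where f: "inj_on f V" "f ` V \<subseteq> {..<n}" "\<And>e. e \<in> E \<Longrightarrow> f ` e \<in> J \<and> c (f ` e) = i"
      unfolding monochromatic_copy_def contains_copy_def J_def by auto
    obtain e0 where "e0 \<in> E"
      using E by auto
    \<comment> \<open>The image of an edge of \<open>H\<close> has colour \<open>i\<close>, so
      \<open>i\<close> occurs in a list and \<open>w i\<close> is really an injection; outside
      \<open>I\<close> it is \<open>undefined\<close>.\<close>
    then have "i \<in> I"
      using f(3) c unfolding I_def by blast
    then have wi: "w i \<in> injections {..<n} {..<N}"
      using w by (auto simp: W_def)
    have "contains_copy V E {..<N} F"
      unfolding contains_copy_def
    proof (intro exI conjI ballI)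
      show "inj_on (w i \<circ> f) V"
        using f wi by (intro comp_inj_on) (auto simp: injections_def intro: inj_on_subset)
      show "(w i \<circ> f) ` V \<subseteq> {..<N}"
        using f wi by (fastforce simp: injections_def)
      show "(w i \<circ> f) ` e \<in> F" if "e \<in> E" for e
        using f(3)[OF that] c[of "f ` e"] by (auto simp: image_comp)
    qed
    then show False
      using free by contradiction
  qed
  moreover have "list_coloring r n L c"
    using c by (auto simp: list_coloring_def J_def)
  ultimately show ?thesis
    using that by blast
qed

section \<open>From the colouring lemma to the lower bound\<close>

text \<open>With the constant lists \<open>{..<k}\<close>, Ramsey's theorem gives a monochromatic
  clique on \<open>card V\<close> vertices, which contains \<open>H\<close>. So the
  \<open>LEAST\<close> is over a nonempty set.\<close>

lemma list_ramsey_number_attained: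
  assumes "uniform_hypergraph r V E"
  obtains L where "L \<in> nsets {..<list_ramsey_number r V E k} r \<rightarrow> nsets (UNIV :: nat set) k"
    "\<And>c. list_coloring r (list_ramsey_number r V E k) L c \<Longrightarrow>
       monochromatic_copy r V E (list_ramsey_number r V E k) c"
proof -
  let ?P = "\<lambda>n. \<exists>L \<in> nsets {..<n} r \<rightarrow> nsets (UNIV :: nat set) k.
        \<forall>c. list_coloring r n L c \<longrightarrow> monochromatic_copy r V E n c"
  have V: "finite V" "E \<subseteq> nsets V r"
    using assms by (auto simp: uniform_hypergraph_def)
  obtain n :: nat where n: "partn_lst {..<n} (replicate k (card V)) r"
    using ramsey_full[of "replicate k (card V)" r] by blast
  have "?P n"
  proof (intro bexI[of _ "\<lambda>_. {..<k}"] allI impI)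
    fix c assume "list_coloring r n (\<lambda>_. {..<k}) c"
    then have "c \<in> nsets {..<n} r \<rightarrow> {..<k}"
      by (auto simp: list_coloring_def)
    then obtain i X where i: "i < k" "X \<in> nsets {..<n} (replicate k (card V) ! i)" "c ` nsets X r \<subseteq> {i}"
      by (rule partn_lstE[OF n _ length_replicate]) simp
    then have X: "X \<subseteq> {..<n}" "finite X" "card X = card V"
      by (auto simp: nsets_def)
    then obtain f where f: "bij_betw f V X"
      using finite_same_card_bij V by metis
    have "f ` e \<in> {e \<in> nsets {..<n} r. c e = i}" if "e \<in> E" for e
    proof -
      have "f ` e \<in> nsets X r"
        using bij_betw_nsets[OF f, of r] that V by (auto simp: bij_betw_def)
      then show ?thesis
        using i(3) nsets_mono[OF X(1), of r] by auto
    qed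
    then show "monochromatic_copy r V E n c"
      using f X(1) unfolding monochromatic_copy_def contains_copy_def
      by (intro exI[of _ i] exI[of _ f]) (auto simp: bij_betw_def)
  qed (auto simp: nsets_def)
  then have "?P (list_ramsey_number r V E k)"
    unfolding list_ramsey_number_def by (rule LeastI)
  then show ?thesis
    using that by blast
qed

text \<open>If the inequality failed, the strict slack would leave room for b < s < q:
  \<open>q\<close> still satisfies the local lemma condition, some \<open>H\<close>-free graph has
  all relative degrees at least \<open>1 - s\<close>, and the gap from \<open>s\<close> to
  \<open>q\<close> covers the values already used. The resulting colouring contradicts the choice of
  \<open>L\<close>.\<close>

lemma list_ramsey_number_power_ge:
  assumes r: "r \<ge> 2" and H: "uniform_hypergraph r V E" and E: "E \<noteq> {}"
  shows "fact (r - 2) \<le> exp 1 * (1 - turan_density r V E) ^ k * real (list_ramsey_number r V E k) ^ (r - 1)"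
proof (rule ccontr)
  define n where "n = list_ramsey_number r V E k"
  define b where "b = 1 - turan_density r V E"
  assume "\<not> ?thesis"
  then have less: "exp 1 * b ^ k * real n ^ (r - 1) < fact (r - 2)"
    by (simp add: n_def b_def)
  have EV: "\<Union>E \<subseteq> V"
    using H by (auto simp: uniform_hypergraph_def nsets_def)
  have b: "b \<ge> 0"
    unfolding b_def using turan_density_le_1[OF E EV] by simp
  have "((\<lambda>q. exp 1 * q ^ k * real n ^ (r - 1)) \<longlongrightarrow> exp 1 * b ^ k * real n ^ (r - 1)) (at_right b)"
    by (intro tendsto_intros)
  then have "\<forall>\<^sub>F q in at_right b. exp 1 * q ^ k * real n ^ (r - 1) < fact (r - 2) \<and> q > b"
    by (intro eventually_conj order_tendstoD(2)[OF _ less] eventually_at_right_less)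
  then obtain q where q: "exp 1 * q ^ k * real n ^ (r - 1) < fact (r - 2)" "q > b"
    using eventually_happens'[OF trivial_limit_at_right_real] by blast
  define s where "s = (b + q) / 2"
  have s: "b < s" "s < q"
    using q(2) by (auto simp: s_def)
  have bound: "exp 1 * q ^ k * real ((r - 1) * ((n - 1) choose (r - 1))) \<le> 1"
  proof -
    \<comment> \<open>Splitting (r - 1)! as (r - 1) (r - 2)! matches the neighbour count and leaves
      the factor (r - 2)! of the constant.\<close>
    have "((n - 1) choose (r - 1)) * fact (r - 1) \<le> n ^ (r - 1)"
      using binomial_fact_pow[of "n - 1" "r - 1"] power_mono[of "n - 1" n "r - 1"] by linarith
    moreover have "fact (r - 1) = (r - 1) * (fact (r - 2) :: nat)"
      using r fact_reduce[of "r - 1", where ?'a = nat] by (simp add: numeral_2_eq_2)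
    ultimately have "fact (r - 2) * ((r - 1) * ((n - 1) choose (r - 1))) \<le> n ^ (r - 1)"
      by (simp add: ac_simps)
    then have "real (fact (r - 2) * ((r - 1) * ((n - 1) choose (r - 1)))) \<le> real (n ^ (r - 1))"
      by (rule of_nat_mono)
    then have "fact (r - 2) * real ((r - 1) * ((n - 1) choose (r - 1))) \<le> real n ^ (r - 1)"
      by (simp only: of_nat_mult of_nat_fact of_nat_power)
    then have "exp 1 * q ^ k * (fact (r - 2) * real ((r - 1) * ((n - 1) choose (r - 1))))
        \<le> exp 1 * q ^ k * real n ^ (r - 1)"
      using s b by (intro mult_left_mono) auto
    then have "fact (r - 2) * (exp 1 * q ^ k * real ((r - 1) * ((n - 1) choose (r - 1)))) \<le> fact (r - 2) * 1"
      using q(1) by (simp only: ac_simps)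
    then show ?thesis
      by (simp only: mult_le_cancel_left_pos[OF fact_gt_zero])
  qed
  obtain n0 where n0: "\<And>N. N \<ge> n0 \<Longrightarrow> s * real (N choose (r - 1)) \<le> q * real ((N - n + (r - 1)) choose (r - 1))"
    using eventually_binomial_shift_le[of s q "r - 1" n] s b unfolding eventually_sequentially by auto
  have "1 - s < turan_density r V E"
    using s(1) by (simp add: b_def)
  then obtain N F where N: "N \<ge> max n n0" and F: "F \<subseteq> nsets {..<Suc N} r" "\<not> contains_copy V E {..<Suc N} F"
    "\<And>v. v < Suc N \<Longrightarrow> (1 - s) * real (N choose (r - 1)) \<le> real (card {e \<in> F. v \<in> e})"
    using exists_large_min_degree[OF E EV, of r "1 - s" "max n n0"] r by auto
  obtain L where L: "L \<in> nsets {..<n} r \<rightarrow> nsets (UNIV :: nat set) k"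
    "\<And>c. list_coloring r n L c \<Longrightarrow> monochromatic_copy r V E n c"
    using list_ramsey_number_attained[OF H] unfolding n_def by metis
  \<comment> \<open>\<open>F\<close> has \<open>Suc N\<close> vertices, so degrees are measured
    against \<open>N choose (r - 1)\<close>; the shift estimate for \<open>N\<close> carries over to
    \<open>Suc N\<close> by monotonicity.\<close>
  have "real (card {D \<in> nsets ({..<Suc N} - {x}) (r - 1). insert x D \<notin> F})
      \<le> q * real ((Suc N - n + (r - 1)) choose (r - 1))" if x: "x < Suc N" for x
  proof -
    have "real (card {D \<in> nsets ({..<Suc N} - {x}) (r - 1). insert x D \<notin> F}) \<le> s * real (N choose (r - 1))"
      using card_nonlink[OF F(1), of x] F(3)[OF x] x r by (simp add: algebra_simps)
    also have "\<dots> \<le> q * real ((N - n + (r - 1)) choose (r - 1))"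
      using N by (intro n0) simp
    also have "\<dots> \<le> q * real ((Suc N - n + (r - 1)) choose (r - 1))"
      using s b by (intro mult_left_mono of_nat_mono binomial_right_mono) auto
    finally show ?thesis .
  qed
  moreover have "q \<ge> 0" "n \<le> Suc N"
    using s b N by auto
  ultimately obtain c where "list_coloring r n L c" "\<not> monochromatic_copy r V E n c"
    using exists_list_coloring_without_monochromatic_copy[OF r E EV L(1) _ bound _ F(2)] by blast
  then show False
    using L(2) by blast
qed

text \<open>All vertices go into part 0. Hence a graph that is not \<open>r\<close>-partite has an
  edge, as the results on the Turan density require.\<close>

lemma r_partite_empty:
  assumes "r > 0"
  shows "r_partite r V {}"
  unfolding r_partite_def
proof (intro exI conjI)
  show "disjoint_family_on (\<lambda>i. if i = 0 then V else {}) {..<r}"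
    by (auto simp: disjoint_family_on_def)
qed (use assms in auto)

theorem theorem2:
  fixes r k :: nat and V :: "'a set" and E :: "'a set set"
  assumes "r \<ge> 2"
    and "uniform_hypergraph r V E"
    and "\<not> r_partite r V E"
    and "k \<ge> 1"
  shows "real (list_ramsey_number r V E k) \<ge>
    (fact (r - 2) / exp 1) powr (1 / (real r - 1)) *
      (1 - turan_density r V E) powr (- real k / (real r - 1))"
proof -
  define n where "n = real (list_ramsey_number r V E k)"
  define b where "b = 1 - turan_density r V E"
  have E: "E \<noteq> {}"
    using assms r_partite_empty[of r V] by auto
  have EV: "\<Union>E \<subseteq> V"
    using assms by (auto simp: uniform_hypergraph_def nsets_def)
  have "b \<ge> 0"
    using turan_density_le_1[OF E EV] by (simp add: b_def)
  \<comment> \<open>For b = 0 the power \<open>b powr _\<close> is 0 by convention and the bound is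
    trivial; for b > 0 the (r - 1)-th root of the preceding inequality is taken.\<close>
  then consider "b = 0" | "b > 0"
    by linarith
  then have "(fact (r - 2) / exp 1) powr (1 / (real r - 1)) * b powr (- real k / (real r - 1)) \<le> n"
  proof cases
    case 2
    have main: "fact (r - 2) \<le> exp 1 * b ^ k * n ^ (r - 1)"
      using list_ramsey_number_power_ge[OF assms(1,2) E] by (simp add: b_def n_def)
    have "(0::real) < fact (r - 2)"
      by simp
    with main have "n ^ (r - 1) \<noteq> 0"
      by (metis mult_zero_right not_less)
    then have n: "n > 0"
      using assms(1) by (auto simp: n_def power_0_left)
    have rr: "real (r - 1) = real r - 1"
      using assms(1) by (simp add: of_nat_diff)
    have "(fact (r - 2) / exp 1) powr (1 / (real r - 1)) * b powr (- real k / (real r - 1))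
        = (fact (r - 2) / exp 1 * b powr (- real k)) powr (1 / (real r - 1))"
      unfolding powr_mult powr_powr by simp
    also have "\<dots> \<le> (n ^ (r - 1)) powr (1 / (real r - 1))"
    proof (rule powr_mono2)
      show "fact (r - 2) / exp 1 * b powr (- real k) \<le> n ^ (r - 1)"
        using main 2 by (simp add: powr_minus powr_realpow field_simps)
    qed (use assms(1) 2 in auto)
    also have "\<dots> = n"
      using n assms(1) rr by (simp add: powr_realpow[symmetric] powr_powr)
    finally show ?thesis .
  qed (simp add: n_def)
  then show ?thesis
    by (simp add: n_def b_def)
qed

end
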